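(* Let $L$ be a restricted Lie algebra over a field $\mathbb F$ of characteristic $2$ and let $M$ be a restricted $L$-module. The complex $\left(C^n_{*_2}(L,M),d^n_{*_2}\right)_{n\ge0}$ is a cochain complex. The $n$-th restricted cohomology group of the Lie algebra $L$ in characteristic $2$ is defined by $H^n_{*_2}(L,M):=Z^n_{*_2}(L,M)/B^n_{*_2}(L,M)$, with $Z^n_{*_2}(L,M)=\ker(d^n_{*_2})$ the restricted $n$-cocycles and $B^n_{*_2}(L,M)=\mathrm{Im}(d^{n-1}_{*_2})$ the restricted $n$-coboundaries.
   Context: All algebras are finite-dimensional. A restricted Lie algebra in characteristic $2$ is a Lie algebra $L$ with a map $(\cdot)^{[2]}:L\to L$ such that $(\lambda x)^{[2]}=\lambda^2x^{[2]}$, $[x,y^{[2]}]=[[x,y],y]$, $(x+y)^{[2]}=x^{[2]}+y^{[2]}+[x,y]$. An $L$-module $M$ is restricted if $x^{[2]}\cdot m=x\cdot(x\cdot m)$. $C^n_{CE}(L,M)$ is the space of alternating $n$-linear maps $L^n\to M$ ($C^0_{CE}(L,M)=M$), with Chevalley-Eilenberg differential (in characteristic 2) $$d^n_{CE}\varphi(x_1,\dots,x_{n+1})=\sum_{i<j}\varphi([x_i,x_j],x_1,\dots,\hat{x_i},\dots,\hat{x_j},\dots,x_{n+1})+\sum_i x_i\cdot\varphi(x_1,\dots,\hat{x_i},\dots,x_{n+1}).$$ Cochains: $C^0_{*_2}(L,M)=C^0_{CE}(L,M)$, $C^1_{*_2}(L,M)=C^1_{CE}(L,M)$. For $n\ge2$,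 $C^n_{*_2}(L,M)$ is the set of pairs $(\varphi,\omega)$ with $\varphi\in C^n_{CE}(L,M)$ and $\omega:L^{n-1}\to M$ such that $$\omega(\lambda x,z_2,\dots,z_{n-1})=\lambda^2\omega(x,z_2,\dots,z_{n-1}),$$ $$\omega(x,z_2,\dots,\lambda z_i+z_i',\dots,z_{n-1})=\lambda\omega(x,z_2,\dots,z_i,\dots,z_{n-1})+\omega(x,z_2,\dots,z_i',\dots,z_{n-1}),$$ $$\omega(x+y,z_2,\dots,z_{n-1})=\omega(x,z_2,\dots,z_{n-1})+\omega(y,z_2,\dots,z_{n-1})+\varphi(x,y,z_2,\dots,z_{n-1}).$$ Differentials: $d^0_{*_2}=d^0_{CE}$; $d^1_{*_2}(\varphi)=(d^1_{CE}\varphi,\omega)$ with $\omega(x)=\varphi(x^{[2]})+x\cdot\varphi(x)$; for $n\ge2$, $d^n_{*_2}(\varphi,\omega)=(d^n_{CE}\varphi,\delta^n\omega)$ with $$\begin{aligned}\delta^n\omega(x,z_2,\dots,z_n)=\;&x\cdot\varphi(x,z_2,\dots,z_n)+\sum_{i=2}^nz_i\cdot\omega(x,z_2,\dots,\hat{z_i},\dots,z_n)+\varphi(x^{[2]},z_2,\dots,z_n)\\&+\sum_{i=2}^n\varphi([x,z_i],x,z_2,\dots,\hat{z_i},\dots,z_n)+\sum_{2\le i<j\le n}\omega(x,[z_i,z_j],z_2,\dots,\hat{z_i},\dots,\hat{z_j},\dots,z_n).\end{aligned}$$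
   Formalization: For n ≥ 4 the map ω(x,z_2,…,z_{n-1}) in a cochain (φ,ω) is additionally required to be alternating in z_2,…,z_{n-1}; with ω only multilinear in the z's, d∘d = 0 fails (e.g. on C^4 for a sum of two Heisenberg algebras). *)

theory Defs
  imports Complex_Main "HOL-Library.Function_Algebras" "HOL-Library.Product_Plus" "HOL-Algebra.Coset"
begin

section \<open>Restricted Lie algebras and modules in characteristic 2\<close>

locale restricted_lie_algebra_char2 = vector_space scale
  for scale :: "'k::field \<Rightarrow> 'l::ab_group_add \<Rightarrow> 'l" +
  fixes bracket :: "'l \<Rightarrow> 'l \<Rightarrow> 'l" and sq :: "'l \<Rightarrow> 'l"
  assumes char2: "CHAR('k) = 2"
    and finite_dim: "\<exists>B. finite B \<and> span B = UNIV"
    and bracket_linear_left: "\<And>y. Vector_Spaces.linear scale scale (\<lambda>x. bracket x y)"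
    and bracket_linear_right: "\<And>x. Vector_Spaces.linear scale scale (\<lambda>y. bracket x y)"
    and bracket_self: "\<And>x. bracket x x = 0"
    and jacobi: "\<And>x y z. bracket x (bracket y z) + bracket y (bracket z x) + bracket z (bracket x y) = 0"
    and sq_scale: "\<And>c x. sq (scale c x) = scale (c ^ 2) (sq x)"
    and bracket_sq: "\<And>x y. bracket x (sq y) = bracket (bracket x y) y"
    and sq_add: "\<And>x y. sq (x + y) = sq x + sq y + bracket x y"

locale restricted_lie_module_char2 =
  restricted_lie_algebra_char2 scaleL bracket sq + M: vector_space scaleM
  for scaleL :: "'k::field \<Rightarrow> 'l::ab_group_add \<Rightarrow> 'l"
    and bracket :: "'l \<Rightarrow> 'l \<Rightarrow> 'l" and sq :: "'l \<Rightarrow> 'l"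
    and scaleM :: "'k \<Rightarrow> 'm::ab_group_add \<Rightarrow> 'm" +
  fixes act :: "'l \<Rightarrow> 'm \<Rightarrow> 'm"
  assumes act_linear_left: "\<And>m. Vector_Spaces.linear scaleL scaleM (\<lambda>x. act x m)"
    and act_linear_right: "\<And>x. Vector_Spaces.linear scaleM scaleM (act x)"
    and act_bracket: "\<And>x y m. act (bracket x y) m = act x (act y m) - act y (act x m)"
    and act_sq: "\<And>x m. act (sq x) m = act x (act x m)"

section \<open>Cochains\<close>

text \<open>
  A map on \<open>L\<^sup>n\<close> is a function on lists which is \<open>0\<close> on all lists of length different from
  \<open>n\<close>, so that equality of such functions is equality of maps on \<open>L\<^sup>n\<close>. Positions are counted
  from \<open>0\<close>.
\<close>

definition supported_on_length :: "nat \<Rightarrow> ('l list \<Rightarrow> 'm::zero) \<Rightarrow> bool" where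
  "supported_on_length n f \<longleftrightarrow> (\<forall>xs. length xs \<noteq> n \<longrightarrow> f xs = 0)"

definition multilinear ::
  "('k \<Rightarrow> 'l \<Rightarrow> 'l::plus) \<Rightarrow> ('k \<Rightarrow> 'm \<Rightarrow> 'm::plus) \<Rightarrow> nat \<Rightarrow> ('l list \<Rightarrow> 'm) \<Rightarrow> bool" where
  "multilinear scaleL scaleM n f \<longleftrightarrow>
     (\<forall>xs i c a b. length xs = n \<longrightarrow> i < n \<longrightarrow>
        f (xs[i := scaleL c a + b]) = scaleM c (f (xs[i := a])) + f (xs[i := b]))"

definition alternating :: "nat \<Rightarrow> ('l list \<Rightarrow> 'm::zero) \<Rightarrow> bool" where
  "alternating n f \<longleftrightarrow>
     (\<forall>xs i j. length xs = n \<longrightarrow> i < j \<longrightarrow> j < n \<longrightarrow> xs ! i = xs ! j \<longrightarrow> f xs = 0)"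

definition CE_cochains ::
  "('k \<Rightarrow> 'l \<Rightarrow> 'l::plus) \<Rightarrow> ('k \<Rightarrow> 'm \<Rightarrow> 'm::{plus,zero}) \<Rightarrow> nat \<Rightarrow> ('l list \<Rightarrow> 'm) set" where
  "CE_cochains scaleL scaleM n =
     {\<phi>. supported_on_length n \<phi> \<and> multilinear scaleL scaleM n \<phi> \<and> alternating n \<phi>}"

text \<open>
  All cochain spaces live in one type of pairs \<open>(\<phi>, \<omega>)\<close>. For \<open>n < 2\<close> there is no \<open>\<omega>\<close>, and it is
  required to be \<open>0\<close>, which identifies \<open>\<phi>\<close> with \<open>(\<phi>, 0)\<close>. For \<open>n \<ge> 2\<close> the map
  \<open>\<omega> : L\<^sup>n\<^sup>-\<^sup>1 \<rightarrow> M\<close> takes its first argument \<open>x\<close> separately and then the list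
  \<open>zs\<close> of the remaining \<open>n - 2\<close> arguments, in which it is linear.

  The clause \<open>alternating (n - 2) (\<omega> x)\<close> is vacuous for \<open>n \<le> 3\<close>. For \<open>n \<ge> 4\<close> it is essential: the
  double-bracket terms \<open>\<omega> x ([z, z'] # [u, u'] # _)\<close> and \<open>\<omega> x ([u, u'] # [z, z'] # _)\<close> both
  occur in the square of the differential, and nothing cancels them when \<open>\<omega>\<close> is only
  multilinear in \<open>zs\<close>.
\<close>

type_synonym ('l, 'm) cochain = "('l list \<Rightarrow> 'm) \<times> ('l \<Rightarrow> 'l list \<Rightarrow> 'm)"

definition res_cochains ::
  "('k::monoid_mult \<Rightarrow> 'l \<Rightarrow> 'l::plus) \<Rightarrow> ('k \<Rightarrow> 'm \<Rightarrow> 'm::{plus,zero}) \<Rightarrow> nat \<Rightarrow> ('l, 'm) cochain set"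
where
  "res_cochains scaleL scaleM n =
     (if n < 2 then {(\<phi>, \<omega>). \<phi> \<in> CE_cochains scaleL scaleM n \<and> \<omega> = (\<lambda>x zs. 0)}
      else {(\<phi>, \<omega>). \<phi> \<in> CE_cochains scaleL scaleM n \<and>
        (\<forall>x. supported_on_length (n - 2) (\<omega> x)) \<and>
        (\<forall>c x zs. length zs = n - 2 \<longrightarrow> \<omega> (scaleL c x) zs = scaleM (c ^ 2) (\<omega> x zs)) \<and>
        (\<forall>x. multilinear scaleL scaleM (n - 2) (\<omega> x)) \<and>
        (\<forall>x y zs. length zs = n - 2 \<longrightarrow> \<omega> (x + y) zs = \<omega> x zs + \<omega> y zs + \<phi> (x # y # zs)) \<and>
        (\<forall>x. alternating (n - 2) (\<omega> x))})"

definition cochain_scale :: "('k \<Rightarrow> 'm \<Rightarrow> 'm) \<Rightarrow> 'k \<Rightarrow> ('l, 'm) cochain \<Rightarrow> ('l, 'm) cochain" where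
  "cochain_scale scaleM c = (\<lambda>(\<phi>, \<omega>). (\<lambda>xs. scaleM c (\<phi> xs), \<lambda>x zs. scaleM c (\<omega> x zs)))"

section \<open>Differentials\<close>

definition omit :: "nat \<Rightarrow> 'a list \<Rightarrow> 'a list" where
  "omit i xs = take i xs @ drop (Suc i) xs"

definition CE_diff ::
  "('l \<Rightarrow> 'l \<Rightarrow> 'l) \<Rightarrow> ('l \<Rightarrow> 'm \<Rightarrow> 'm) \<Rightarrow> nat \<Rightarrow> ('l list \<Rightarrow> 'm) \<Rightarrow> 'l list \<Rightarrow> 'm::comm_monoid_add"
where
  "CE_diff bracket act n \<phi> xs =
     (if length xs = Suc n
      then (\<Sum>j<Suc n. \<Sum>i<j. \<phi> (bracket (xs ! i) (xs ! j) # omit i (omit j xs)))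
         + (\<Sum>i<Suc n. act (xs ! i) (\<phi> (omit i xs)))
      else 0)"

definition res_delta ::
  "('l \<Rightarrow> 'l \<Rightarrow> 'l) \<Rightarrow> ('l \<Rightarrow> 'l) \<Rightarrow> ('l \<Rightarrow> 'm \<Rightarrow> 'm) \<Rightarrow> nat \<Rightarrow> ('l, 'm) cochain \<Rightarrow>
     'l \<Rightarrow> 'l list \<Rightarrow> 'm::comm_monoid_add"
where
  "res_delta bracket sq act n = (\<lambda>(\<phi>, \<omega>) x zs.
     (if length zs = n - 1
      then act x (\<phi> (x # zs))
         + (\<Sum>i<n - 1. act (zs ! i) (\<omega> x (omit i zs)))
         + \<phi> (sq x # zs)
         + (\<Sum>i<n - 1. \<phi> (bracket x (zs ! i) # x # omit i zs))
         + (\<Sum>j<n - 1. \<Sum>i<j. \<omega> x (bracket (zs ! i) (zs ! j) # omit i (omit j zs)))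
      else 0))"

definition res_diff ::
  "('l \<Rightarrow> 'l \<Rightarrow> 'l) \<Rightarrow> ('l \<Rightarrow> 'l) \<Rightarrow> ('l \<Rightarrow> 'm \<Rightarrow> 'm) \<Rightarrow> nat \<Rightarrow>
     ('l, 'm::comm_monoid_add) cochain \<Rightarrow> ('l, 'm) cochain"
where
  "res_diff bracket sq act n = (\<lambda>(\<phi>, \<omega>).
     (CE_diff bracket act n \<phi>,
      if n = 0 then (\<lambda>x zs. 0)
      else if n = 1 then (\<lambda>x zs. if zs = [] then \<phi> [sq x] + act x (\<phi> [x]) else 0)
      else res_delta bracket sq act n (\<phi>, \<omega>)))"

section \<open>Cochain complexes of subspaces and their cohomology\<close>

locale cochain_complex = vector_space scale
  for scale :: "'k::field \<Rightarrow> 'c::ab_group_add \<Rightarrow> 'c" +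
  fixes C :: "nat \<Rightarrow> 'c set" and d :: "nat \<Rightarrow> 'c \<Rightarrow> 'c"
  assumes subspace_C: "\<And>n. subspace (C n)"
    and d_closed: "\<And>n u. u \<in> C n \<Longrightarrow> d n u \<in> C (Suc n)"
    and d_add: "\<And>n u v. u \<in> C n \<Longrightarrow> v \<in> C n \<Longrightarrow> d n (u + v) = d n u + d n v"
    and d_scale: "\<And>n c u. u \<in> C n \<Longrightarrow> d n (scale c u) = scale c (d n u)"
    and d_d: "\<And>n u. u \<in> C n \<Longrightarrow> d (Suc n) (d n u) = 0"

definition cocycles :: "(nat \<Rightarrow> 'c set) \<Rightarrow> (nat \<Rightarrow> 'c \<Rightarrow> 'c::zero) \<Rightarrow> nat \<Rightarrow> 'c set" where
  "cocycles C d n = {u \<in> C n. d n u = 0}"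

fun coboundaries :: "(nat \<Rightarrow> 'c set) \<Rightarrow> (nat \<Rightarrow> 'c \<Rightarrow> 'c::zero) \<Rightarrow> nat \<Rightarrow> 'c set" where
  "coboundaries C d 0 = {0}"
| "coboundaries C d (Suc n) = d n ` C n"

definition cocycle_group ::
  "(nat \<Rightarrow> 'c set) \<Rightarrow> (nat \<Rightarrow> 'c \<Rightarrow> 'c::monoid_add) \<Rightarrow> nat \<Rightarrow> 'c monoid" where
  "cocycle_group C d n = \<lparr>carrier = cocycles C d n, monoid.mult = (+), one = 0\<rparr>"

definition cohomology ::
  "(nat \<Rightarrow> 'c set) \<Rightarrow> (nat \<Rightarrow> 'c \<Rightarrow> 'c::monoid_add) \<Rightarrow> nat \<Rightarrow> 'c set monoid" where
  "cohomology C d n = cocycle_group C d n Mod coboundaries C d n"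

end

theory Submission
  imports Defs
begin

text \<open>
  For \<open>x \<in> L\<close> let \<open>\<iota>\<^sub>x\<close> be the contraction \<open>contr x\<close> (insertion of \<open>x\<close> as first argument) and
  \<open>\<theta>\<^sub>x\<close> the Lie derivative \<open>lie x\<close>. Cartan's formula \<open>\<iota>\<^sub>x d = \<theta>\<^sub>x + d \<iota>\<^sub>x\<close> reduces every identity
  between cochains to one of lower degree; \<open>d d = 0\<close>, \<open>d \<theta>\<^sub>x = \<theta>\<^sub>x d\<close>, \<open>\<theta>\<^sub>x \<theta>\<^sub>x = \<theta>\<^bsub>sq x\<^esub>\<close> and
  \<open>\<theta>\<^sub>x \<iota>\<^sub>y = \<iota>\<^sub>y \<theta>\<^sub>x + \<iota>\<^bsub>[x, y]\<^esub>\<close> follow by induction. With \<open>\<omega>\<^sub>x = \<omega>(x, -)\<close>, the second component of the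
  restricted differential is \<open>\<theta>\<^sub>x \<iota>\<^sub>x \<phi> + \<iota>\<^bsub>sq x\<^esub> \<phi> + d \<omega>\<^sub>x\<close> in all degrees, and applying it twice gives
  \<open>(\<theta>\<^sub>x \<theta>\<^sub>x + \<theta>\<^bsub>sq x\<^esub>) \<phi> + (\<theta>\<^sub>x d + d \<theta>\<^sub>x) \<iota>\<^sub>x \<phi> = 0\<close>; terms occurring twice cancel in
  characteristic 2.
\<close>

section \<open>Contraction of functions on lists\<close>

definition contr :: "'a \<Rightarrow> ('a list \<Rightarrow> 'b) \<Rightarrow> 'a list \<Rightarrow> 'b" where
  "contr x f = (\<lambda>zs. f (x # zs))"

lemma contr_apply: "contr x f zs = f (x # zs)"
  by (simp add: contr_def)

text \<open>
  Induction rules leave cochains eta-expanded, and pointwise rewriting would then unfold the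
  operations on cochains. Hence it is only enabled on request, and at the empty list.
\<close>

lemmas pointwise = contr_apply plus_fun_apply zero_fun_apply

declare plus_fun_apply [simp del] zero_fun_apply [simp del]

lemmas at_Nil [simp] =
  contr_apply[of _ _ "[]"] plus_fun_apply[of _ _ "[]"] zero_fun_apply[of "[]"]

lemma contr_zero [simp]: "contr x (0 :: 'a list \<Rightarrow> 'b::zero) = 0"
  by (simp add: fun_eq_iff pointwise)

lemma contr_add: "contr x (f + g) = contr x f + contr x g"
  by (simp add: fun_eq_iff pointwise)

text \<open>Extensionality by the head of the list, in the shape needed for induction on the degree:
  the value at \<open>[]\<close> is computed directly, the contractions go to the induction
  hypothesis.\<close>

lemma contr_ext:
  assumes "f [] = g []" and "\<And>x. contr x f = contr x g"
  shows "f = g"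
proof
  fix zs
  show "f zs = g zs"
    using assms(1) fun_cong[OF assms(2)] by (cases zs) (auto simp: pointwise)
qed

lemma omit_0 [simp]: "omit 0 (x # xs) = xs"
  and omit_Suc [simp]: "omit (Suc i) (x # xs) = x # omit i xs"
  by (simp_all add: omit_def)

context restricted_lie_module_char2
begin

section \<open>Signless arithmetic in characteristic 2\<close>

lemma two_eq_zero: "(1 + 1 :: 'k) = 0"
  using char2 of_nat_CHAR[where 'a='k] by simp

lemma algebra_double [simp]: "(x::'l) + x = 0"
  using scale_left_distrib[of 1 1 x] two_eq_zero by simp

lemma module_double [simp]: "(m::'m) + m = 0"
  using M.scale_left_distrib[of 1 1 m] two_eq_zero by simp

lemma cochain_double [simp]: "(f::'l list \<Rightarrow> 'm) + f = 0"
  by (simp add: fun_eq_iff pointwise)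

lemma cochain_double_left [simp]: "(f::'l list \<Rightarrow> 'm) + (f + g) = g"
  by (simp add: fun_eq_iff pointwise)

lemma eq_if_add_eq_zero: "x + y = 0 \<Longrightarrow> x = (y::'l)"
  by (metis add.right_cancel algebra_double)

lemma bracket_add_left: "bracket (x + y) z = bracket x z + bracket y z"
  using bracket_linear_left[of z] by (simp add: Vector_Spaces.linear_iff)

lemma bracket_add_right: "bracket x (y + z) = bracket x y + bracket x z"
  using bracket_linear_right[of x] by (simp add: Vector_Spaces.linear_iff)

lemma bracket_scale_left: "bracket (scaleL c x) z = scaleL c (bracket x z)"
  using bracket_linear_left[of z] by (simp add: Vector_Spaces.linear_iff)

lemma bracket_scale_right: "bracket x (scaleL c z) = scaleL c (bracket x z)"
  using bracket_linear_right[of x] by (simp add: Vector_Spaces.linear_iff)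

lemma bracket_commute: "bracket x y = bracket y x"
proof (rule eq_if_add_eq_zero)
  have "bracket (x + y) (x + y) = bracket x x + bracket x y + (bracket y x + bracket y y)"
    by (simp only: bracket_add_left bracket_add_right) (simp only: add_ac)
  then show "bracket x y + bracket y x = 0"
    by (simp add: bracket_self)
qed

text \<open>The Jacobi identity rearranged to say that the adjoint map is a representation, the form
  in which \<open>lie_bracket\<close> uses it.\<close>

lemma bracket_bracket: "bracket (bracket x y) z = bracket x (bracket y z) + bracket y (bracket x z)"
proof (rule eq_if_add_eq_zero)
  have "bracket y (bracket z x) = bracket y (bracket x z)"
    and "bracket z (bracket x y) = bracket (bracket x y) z"
    by (simp_all only: bracket_commute)
  then show "bracket (bracket x y) z + (bracket x (bracket y z) + bracket y (bracket x z)) = 0"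
    using jacobi[of x y z] by (simp add: add_ac)
qed

lemma act_add_left: "act (x + y) m = act x m + act y m"
  using act_linear_left[of m] by (simp add: Vector_Spaces.linear_iff)

lemma act_scale_left: "act (scaleL c x) m = scaleM c (act x m)"
  using act_linear_left[of m] by (simp add: Vector_Spaces.linear_iff)

lemma act_add_right: "act x (m + m') = act x m + act x m'"
  using act_linear_right[of x] by (simp add: Vector_Spaces.linear_iff)

lemma act_scale_right: "act x (scaleM c m) = scaleM c (act x m)"
  using act_linear_right[of x] by (simp add: Vector_Spaces.linear_iff)

lemma act_zero_right [simp]: "act x 0 = 0"
  using act_add_right[of x 0 0] by simp

lemma module_diff_eq_add: "(m::'m) - m' = m + m'"
  by (simp add: diff_eq_eq add.assoc)

definition sc :: "'k \<Rightarrow> ('l list \<Rightarrow> 'm) \<Rightarrow> 'l list \<Rightarrow> 'm" where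
  "sc c f = (\<lambda>zs. scaleM c (f zs))"

lemma sc_apply: "sc c f zs = scaleM c (f zs)"
  by (simp add: sc_def)

lemma sc_Nil [simp]: "sc c f [] = scaleM c (f [])"
  by (rule sc_apply)

lemma sc_zero [simp]: "sc c 0 = 0"
  by (simp add: fun_eq_iff pointwise sc_apply)

lemma sc_add: "sc c (f + g) = sc c f + sc c g"
  by (simp add: fun_eq_iff pointwise sc_apply M.scale_right_distrib)

lemma sc_sc: "sc a (sc b f) = sc (a * b) f"
  by (simp add: fun_eq_iff pointwise sc_apply)

lemma contr_sc: "contr x (sc c f) = sc c (contr x f)"
  by (simp add: fun_eq_iff pointwise sc_apply)

section \<open>Recursive description of alternating maps\<close>

text \<open>Peeling off the first argument makes induction on the degree available. Equal arguments
  are tested only in the first two slots, at every depth; adjacent swaps yield the general case. In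
  degree 0 the condition confines \<open>f\<close> to \<open>[]\<close>.\<close>

primrec alt :: "nat \<Rightarrow> ('l list \<Rightarrow> 'm) \<Rightarrow> bool" where
  "alt 0 f \<longleftrightarrow> (\<forall>x. contr x f = 0)"
| "alt (Suc n) f \<longleftrightarrow> f [] = 0 \<and> (\<forall>x. alt n (contr x f)) \<and>
     (\<forall>c x y. contr (scaleL c x + y) f = sc c (contr x f) + contr y f) \<and>
     (\<forall>x. contr x (contr x f) = 0)"

lemma alt_zero [simp]: "alt n 0"
  by (induction n) simp_all

lemma alt_add: "alt n f \<Longrightarrow> alt n g \<Longrightarrow> alt n (f + g)"
proof (induction n arbitrary: f g)
  case (Suc n)
  then show ?case
    by (simp add: contr_add sc_add add_ac)
qed (simp add: contr_add)

lemma alt_sc: "alt n f \<Longrightarrow> alt n (sc c f)"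
proof (induction n arbitrary: f)
  case (Suc n)
  then show ?case
    by (simp add: contr_sc sc_add sc_sc mult.commute)
qed (simp add: contr_sc)

text \<open>Truncated subtraction is harmless: in degree 0 the contraction is
  \<open>0\<close>.\<close>

lemma alt_contr: "alt n f \<Longrightarrow> alt (n - 1) (contr x f)"
  by (cases n) auto

lemma alt_contr_linear: "alt n f \<Longrightarrow> contr (scaleL c x + y) f = sc c (contr x f) + contr y f"
  by (cases n) auto

lemma alt_contr_add: "alt n f \<Longrightarrow> contr (x + y) f = contr x f + contr y f"
  using alt_contr_linear[of n f 1 x y] by (simp add: fun_eq_iff pointwise sc_apply)

lemma alt_contr_zero: "alt n f \<Longrightarrow> contr 0 f = 0"
  using alt_contr_add[of n f 0 0] by simp

lemma alt_contr_scale: "alt n f \<Longrightarrow> contr (scaleL c x) f = sc c (contr x f)"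
  using alt_contr_linear[of n f c x 0] by (simp add: alt_contr_zero)

lemma alt_contr_self: "alt n f \<Longrightarrow> contr x (contr x f) = 0"
  by (cases n) auto

text \<open>Polarization of the vanishing double contraction; in characteristic 2 no sign
  appears.\<close>

lemma alt_contr_commute:
  assumes "alt n f"
  shows "contr x (contr y f) = contr y (contr x f)"
proof -
  have "contr (x + y) (contr (x + y) f) = contr x (contr y f) + contr y (contr x f)"
    by (simp add: alt_contr_add[OF assms] alt_contr_add[OF alt_contr[OF assms]] contr_add
        alt_contr_self[OF assms] add_ac)
  then show ?thesis
    using alt_contr_self[OF assms, of "x + y"]
    by (metis add.right_neutral cochain_double_left)
qed

lemma alt_length: "alt n f \<Longrightarrow> length zs \<noteq> n \<Longrightarrow> f zs = 0"
proof (induction n arbitrary: f zs)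
  case 0
  then show ?case
    by (cases zs) (auto simp: fun_eq_iff pointwise sc_apply)
next
  case (Suc n)
  then show ?case
    by (cases zs) (auto, metis contr_apply)
qed

text \<open>One adjacent swap per position passed, none with a sign. This matches replacement in
  place, as in \<open>lie\<close>, with insertion at the front, as in
  \<open>CE_diff\<close>.\<close>

lemma alt_move_front:
  "alt n f \<Longrightarrow> j < length zs \<Longrightarrow> f (zs[j := a]) = f (a # omit j zs)"
proof (induction j arbitrary: n f zs)
  case 0
  then show ?case by (cases zs) auto
next
  case (Suc j)
  then obtain z zs' where zs: "zs = z # zs'" by (cases zs) auto
  have "f (zs[Suc j := a]) = contr z f (zs'[j := a])"
    by (simp add: zs contr_apply)
  also have "\<dots> = contr z f (a # omit j zs')"
    using Suc.IH[OF alt_contr[OF Suc.prems(1)]] Suc.prems(2) zs by simp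
  also have "\<dots> = contr a (contr z f) (omit j zs')" by (simp add: contr_apply)
  also have "\<dots> = contr z (contr a f) (omit j zs')"
    by (simp only: alt_contr_commute[OF Suc.prems(1), of a z])
  finally show ?case by (simp add: zs contr_apply)
qed

lemma alt_imp_multilinear: "alt n f \<Longrightarrow> multilinear scaleL scaleM n f"
proof (induction n arbitrary: f)
  case (Suc n)
  show ?case
    unfolding multilinear_def
  proof (intro allI impI)
    fix xs :: "'l list" and i c a b
    assume len: "length xs = Suc n" and "i < Suc n"
    then obtain x zs where xs: "xs = x # zs" by (cases xs) auto
    show "f (xs[i := scaleL c a + b]) = scaleM c (f (xs[i := a])) + f (xs[i := b])"
    proof (cases i)
      case 0
      then show ?thesis
        using fun_cong[OF alt_contr_linear[OF Suc.prems, of c a b], of zs]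
        by (simp add: xs pointwise sc_apply)
    next
      case i: (Suc i')
      have "multilinear scaleL scaleM n (contr x f)"
        using Suc.IH Suc.prems by simp
      then show ?thesis
        using \<open>i < Suc n\<close> len unfolding multilinear_def by (simp add: xs i contr_apply)
    qed
  qed
qed (simp add: multilinear_def)

lemma alt_imp_alternating: "alt n f \<Longrightarrow> alternating n f"
proof (induction n arbitrary: f)
  case (Suc n)
  show ?case
    unfolding alternating_def
  proof (intro allI impI)
    fix xs :: "'l list" and i j
    assume len: "length xs = Suc n" and ij: "i < j" "j < Suc n" "xs ! i = xs ! j"
    then obtain x zs j' where xs: "xs = x # zs" and j: "j = Suc j'" 
      by (cases xs; cases j) auto
    show "f xs = 0"
    proof (cases i)
      case 0
      \<comment> \<open>The repeated entry is written as an update of \<open>zs\<close> by its own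
        value, so that \<open>alt_move_front\<close> applies.\<close>
      have "f xs = contr x f (zs[j' := x])"
        using 0 ij by (simp add: xs j list_update_same_conv len contr_apply)
      also have "\<dots> = contr x (contr x f) (omit j' zs)"
        using alt_move_front[OF alt_contr[OF Suc.prems]] ij len by (simp add: xs j contr_apply)
      finally show ?thesis
        by (simp add: alt_contr_self[OF Suc.prems] zero_fun_apply)
    next
      case i: (Suc i')
      have "alternating n (contr x f)"
        using Suc.IH Suc.prems by simp
      then show ?thesis
        using ij len unfolding alternating_def xs j i
        by (metis Suc_less_eq contr_apply length_Cons nat.inject nth_Cons_Suc)
    qed
  qed
qed (simp add: alternating_def)

lemma CE_cochains_contr:
  assumes "f \<in> CE_cochains scaleL scaleM (Suc n)"
  shows "contr x f \<in> CE_cochains scaleL scaleM n"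
proof -
  have sup: "supported_on_length (Suc n) f" and mul: "multilinear scaleL scaleM (Suc n) f"
    and alt: "alternating (Suc n) f"
    using assms by (auto simp: CE_cochains_def)
  have "supported_on_length n (contr x f)"
    using sup by (simp add: supported_on_length_def contr_apply)
  moreover have "multilinear scaleL scaleM n (contr x f)"
    unfolding multilinear_def
  proof (intro allI impI)
    fix xs :: "'l list" and i c a b
    assume "length xs = n" "i < n"
    then show "contr x f (xs[i := scaleL c a + b])
        = scaleM c (contr x f (xs[i := a])) + contr x f (xs[i := b])"
      using mul[unfolded multilinear_def, rule_format, of "x # xs" "Suc i" c a b] by (simp add: contr_apply)
  qed
  moreover have "alternating n (contr x f)"
    unfolding alternating_def
  proof (intro allI impI)
    fix xs :: "'l list" and i j
    assume "length xs = n" "i < j" "j < n" "xs ! i = xs ! j"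
    then show "contr x f xs = 0"
      using alt[unfolded alternating_def, rule_format, of "x # xs" "Suc i" "Suc j"] by (simp add: contr_apply)
  qed
  ultimately show ?thesis by (simp add: CE_cochains_def)
qed

lemma CE_cochains_imp_alt: "f \<in> CE_cochains scaleL scaleM n \<Longrightarrow> alt n f"
proof (induction n arbitrary: f)
  case 0
  then show ?case
    by (simp add: CE_cochains_def supported_on_length_def fun_eq_iff pointwise sc_apply)
next
  case (Suc n)
  have sup: "supported_on_length (Suc n) f" and mul: "multilinear scaleL scaleM (Suc n) f"
    and alt: "alternating (Suc n) f"
    using Suc.prems by (auto simp: CE_cochains_def)
  have "contr (scaleL c x + y) f = sc c (contr x f) + contr y f" for c x y
  proof
    fix zs
    show "contr (scaleL c x + y) f zs = (sc c (contr x f) + contr y f) zs"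
    proof (cases "length zs = n")
      case True
      then show ?thesis
        \<comment> \<open>The entry \<open>0\<close> is a placeholder that the update at position 0
          overwrites.\<close>
        using mul[unfolded multilinear_def, rule_format, of "0 # zs" 0 c x y]
        by (simp add: pointwise sc_apply)
    qed (use sup in \<open>simp add: supported_on_length_def pointwise sc_apply\<close>)
  qed
  moreover have "contr x (contr x f) = 0" for x
  proof
    fix zs
    show "contr x (contr x f) zs = 0 zs"
    proof (cases "Suc (length zs) = n")
      case True
      then show ?thesis
        using alt[unfolded alternating_def, rule_format, of "x # x # zs" 0 1]
        by (simp add: pointwise)
    qed (use sup in \<open>simp add: supported_on_length_def pointwise sc_apply\<close>)
  qed
  moreover have "f [] = 0"
    using sup by (simp add: supported_on_length_def)
  ultimately show ?case
    using Suc.IH[OF CE_cochains_contr[OF Suc.prems]] by simp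
qed

lemma CE_cochains_iff_alt: "f \<in> CE_cochains scaleL scaleM n \<longleftrightarrow> alt n f"
proof
  assume "alt n f"
  then show "f \<in> CE_cochains scaleL scaleM n"
    by (simp add: CE_cochains_def supported_on_length_def alt_length alt_imp_multilinear
        alt_imp_alternating)
qed (rule CE_cochains_imp_alt)

section \<open>Cartan calculus\<close>

text \<open>Summing up to the length of the argument avoids a degree index, so
  \<open>contr_lie\<close> holds for arbitrary functions.\<close>

definition lie :: "'l \<Rightarrow> ('l list \<Rightarrow> 'm) \<Rightarrow> 'l list \<Rightarrow> 'm" where
  "lie x f = (\<lambda>zs. act x (f zs) + (\<Sum>i<length zs. f (zs[i := bracket x (zs ! i)])))"

lemma lie_Nil [simp]: "lie x f [] = act x (f [])"
  by (simp add: lie_def)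

lemma lie_zero [simp]: "lie x 0 = 0"
  by (simp add: lie_def fun_eq_iff pointwise sc_apply)

lemma lie_add: "lie x (f + g) = lie x f + lie x g"
  by (simp add: lie_def fun_eq_iff pointwise sc_apply act_add_right sum.distrib add_ac)

lemma lie_sc: "lie x (sc c f) = sc c (lie x f)"
  by (simp add: lie_def fun_eq_iff pointwise sc_apply act_scale_right M.scale_right_distrib M.scale_sum_right)

text \<open>The summand altering the first argument splits off; the others form the Lie derivative
  of the contraction.\<close>

lemma contr_lie: "contr y (lie x f) = lie x (contr y f) + contr (bracket x y) f"
proof
  fix zs
  show "contr y (lie x f) zs = (lie x (contr y f) + contr (bracket x y) f) zs"
    by (simp add: lie_def pointwise sum.lessThan_Suc_shift add_ac del: sum.lessThan_Suc)
qed

lemma alt_lie: "alt n f \<Longrightarrow> alt n (lie x f)"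
proof (induction n arbitrary: f)
  case 0
  then show ?case by (simp add: contr_lie)
next
  case (Suc n)
  have "contr (scaleL c y + z) (lie x f) = sc c (contr y (lie x f)) + contr z (lie x f)" for c y z
    by (simp only: contr_lie bracket_add_right bracket_scale_right alt_contr_linear[OF Suc.prems]
        lie_add lie_sc sc_add) (simp only: add_ac)
  \<comment> \<open>The two mixed contractions by \<open>y\<close> and \<open>bracket x y\<close>
    coincide and cancel.\<close>
  moreover have "contr y (contr y (lie x f)) = 0" for y
    using alt_contr_commute[OF Suc.prems, of y]
    by (simp add: contr_lie contr_add alt_contr_self[OF Suc.prems])
  moreover have "alt n (contr y (lie x f))" for y
    using Suc by (simp add: contr_lie alt_add)
  ultimately show ?case
    using Suc.prems by simp
qed

lemma lie_linear: "alt n f \<Longrightarrow> lie (scaleL c x + y) f = sc c (lie x f) + lie y f"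
proof (induction n arbitrary: f)
  case 0
  then show ?case
    by - (rule contr_ext, simp_all add: contr_lie contr_add contr_sc act_add_left act_scale_left)
next
  case (Suc n)
  show ?case
  proof (rule contr_ext)
    fix z
    have "lie (scaleL c x + y) (contr z f) = sc c (lie x (contr z f)) + lie y (contr z f)"
      using Suc by simp
    then show "contr z (lie (scaleL c x + y) f) = contr z (sc c (lie x f) + lie y f)"
      by (simp only: contr_lie contr_add contr_sc bracket_add_left bracket_scale_left sc_add
          alt_contr_linear[OF Suc.prems]) (simp only: add_ac)
  qed (simp add: act_add_left act_scale_left)
qed

lemma lie_add_left: "alt n f \<Longrightarrow> lie (x + y) f = lie x f + lie y f"
  using lie_linear[of n f 1 x y] by (simp add: fun_eq_iff pointwise sc_apply)

lemma lie_scale_left: "alt n f \<Longrightarrow> lie (scaleL c x) f = sc c (lie x f)"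
  using lie_linear[of n f c x 0] lie_add_left[of n f 0 0] by simp

text \<open>After contraction by \<open>z\<close> the mixed terms such as
  \<open>lie x (contr (bracket y z) f)\<close> occur twice; the double brackets combine by the
  Jacobi identity.\<close>

lemma lie_bracket: "alt n f \<Longrightarrow> lie x (lie y f) + lie y (lie x f) = lie (bracket x y) f"
proof (induction n arbitrary: f)
  case 0
  then show ?case
    by - (rule contr_ext, simp_all add: contr_lie contr_add act_bracket module_diff_eq_add)
next
  case (Suc n)
  show ?case
  proof (rule contr_ext)
    fix z
    have *: "lie (bracket x y) (contr z f)
        = lie x (lie y (contr z f)) + lie y (lie x (contr z f))"
      using Suc by simp
    show "contr z (lie x (lie y f) + lie y (lie x f)) = contr z (lie (bracket x y) f)"
      by (simp add: contr_lie contr_add lie_add * bracket_bracket alt_contr_add[OF Suc.prems] add_ac)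
  qed (simp add: act_bracket module_diff_eq_add)
qed

text \<open>The restricted structure enters here: \<open>act_sq\<close> settles the empty list, and
  \<open>bracket_sq\<close> the double bracket produced by contraction.\<close>

lemma lie_lie: "alt n f \<Longrightarrow> lie x (lie x f) = lie (sq x) f"
proof (induction n arbitrary: f)
  case 0
  then show ?case
    by - (rule contr_ext, simp_all add: contr_lie act_sq)
next
  case (Suc n)
  show ?case
  proof (rule contr_ext)
    fix z
    have *: "lie (sq x) (contr z f) = lie x (lie x (contr z f))"
      using Suc by simp
    have "bracket (sq x) z = bracket x (bracket x z)"
      using bracket_sq[of z x] by (metis bracket_commute)
    then show "contr z (lie x (lie x f)) = contr z (lie (sq x) f)"
      by (simp add: contr_lie lie_add * add_ac)
  qed (simp add: act_sq)
qed

section \<open>The Chevalley-Eilenberg differential\<close>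

abbreviation D :: "nat \<Rightarrow> ('l list \<Rightarrow> 'm) \<Rightarrow> 'l list \<Rightarrow> 'm" where
  "D \<equiv> CE_diff bracket act"

lemma D_zero [simp]: "D n 0 = 0"
  by (simp add: CE_diff_def fun_eq_iff pointwise sc_apply)

lemma D_add: "D n (f + g) = D n f + D n g"
  by (simp add: CE_diff_def fun_eq_iff pointwise sc_apply act_add_right sum.distrib add_ac del: sum.lessThan_Suc)

lemma D_sc: "D n (sc c f) = sc c (D n f)"
  by (simp add: CE_diff_def fun_eq_iff pointwise sc_apply act_scale_right M.scale_right_distrib M.scale_sum_right
      del: sum.lessThan_Suc)

lemma D_Nil [simp]: "D n f [] = 0"
  by (simp add: CE_diff_def)

text \<open>Cartan's formula; for \<open>n = 0\<close> the last summand is \<open>0\<close>, because \<open>contr x f\<close> is.\<close>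

lemma contr_D:
  assumes f: "alt n f"
  shows "contr x (D n f) = lie x f + D (n - 1) (contr x f)"
proof
  fix zs
  show "contr x (D n f) zs = (lie x f + D (n - 1) (contr x f)) zs"
  proof (cases "length zs = n")
    case False
    have "lie x f zs = 0"
      using False by (simp add: lie_def alt_length[OF f])
    moreover have "D (n - 1) (contr x f) zs = 0"
      using False f by (cases n) (auto simp: CE_diff_def pointwise)
    ultimately show ?thesis
      using False by (simp add: pointwise CE_diff_def)
  next
    case len: True
    show ?thesis
    proof (cases n)
      case 0
      then show ?thesis
        using len by (simp add: pointwise CE_diff_def)
    next
      case (Suc m)
      \<comment> \<open>Brings \<open>x\<close> back to the front, where it is absorbed into
        \<open>contr x f\<close>.\<close>
      have swap: "f (a # x # us) = f (x # a # us)" for a us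
        using fun_cong[OF alt_contr_commute[OF f, of x a], of us] by (simp add: contr_apply)
      have "(\<Sum>j<n. f (bracket x (zs ! j) # omit j zs)) = (\<Sum>j<n. f (zs[j := bracket x (zs ! j)]))"
        using len by (intro sum.cong) (simp_all add: alt_move_front[OF f])
      \<comment> \<open>Terms in which \<open>x\<close> is bracketed or acts make up
        \<open>lie x f\<close>; those in which it remains an argument make up the differential of
        \<open>contr x f\<close>.\<close>
      moreover have "D n f (x # zs) = (\<Sum>j<n. f (bracket x (zs ! j) # omit j zs)
            + (\<Sum>i<j. f (x # bracket (zs ! i) (zs ! j) # omit i (omit j zs))))
          + (act x (f zs) + (\<Sum>i<n. act (zs ! i) (f (x # omit i zs))))"
        using len by (simp add: pointwise CE_diff_def sum.lessThan_Suc_shift swap del: sum.lessThan_Suc)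
      ultimately show ?thesis
        using len Suc
        by (simp add: pointwise CE_diff_def lie_def sum.distrib add_ac del: sum.lessThan_Suc)
    qed
  qed
qed

text \<open>By Cartan's formula the contractions of \<open>D n f\<close> inherit linearity and
  alternation from \<open>lie\<close> and from lower degree.\<close>

lemma alt_D: "alt n f \<Longrightarrow> alt (Suc n) (D n f)"
proof (induction n arbitrary: f)
  case 0
  then show ?case
    using alt_lie[of 0 f] lie_linear[of 0 f] by (simp add: contr_D contr_lie)
next
  case (Suc n)
  note f = \<open>alt (Suc n) f\<close>
  have c: "contr x (D (Suc n) f) = lie x f + D n (contr x f)" for x
    using contr_D[OF f] by simp
  have "contr (scaleL a x + y) (D (Suc n) f)
      = sc a (contr x (D (Suc n) f)) + contr y (D (Suc n) f)" for a x y
    by (simp only: c lie_linear[OF f] alt_contr_linear[OF f] D_add D_sc sc_add)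
      (simp only: add_ac)
  moreover have "contr x (contr x (D (Suc n) f)) = 0" for x
  proof -
    \<comment> \<open>Cartan's formula for \<open>contr x f\<close>, whose own contraction by
      \<open>x\<close> vanishes. The result cancels the term coming from
      \<open>lie x f\<close>.\<close>
    have "contr x (D n (contr x f)) = lie x (contr x f)"
      using contr_D[OF alt_contr[OF f], of x x] by (simp add: alt_contr_self[OF f])
    then show ?thesis
      by (simp add: c contr_add contr_lie bracket_self alt_contr_zero[OF f])
  qed
  moreover have "alt (Suc n) (contr x (D (Suc n) f))" for x
    unfolding c using f Suc.IH by (intro alt_add alt_lie) simp_all
  ultimately show ?case
    using alt.simps(2)[of "Suc n" "D (Suc n) f"] by simp
qed

text \<open>Contracting both sides by \<open>z\<close> leaves the induction hypothesis for
  \<open>contr z f\<close> and the commutator formula \<open>lie_bracket\<close> for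
  \<open>z\<close> and \<open>x\<close>.\<close>

lemma D_lie: "alt n f \<Longrightarrow> D n (lie x f) = lie x (D n f)"
proof (induction n arbitrary: f)
  case 0
  then show ?case
    using lie_bracket[of 0 f x]
    by - (rule contr_ext, simp_all add: contr_D alt_lie contr_lie lie_add flip: lie_bracket[of 0 f])
next
  case (Suc n)
  note f = \<open>alt (Suc n) f\<close>
  have c: "contr x (D (Suc n) g) = lie x g + D n (contr x g)" if "alt (Suc n) g" for x g
    using contr_D[OF that] by simp
  show ?case
  proof (rule contr_ext)
    fix z
    have "D n (lie x (contr z f)) = lie x (D n (contr z f))"
      using Suc by simp
    then show "contr z (D (Suc n) (lie x f)) = contr z (lie x (D (Suc n) f))"
      by (simp add: c[OF f] c[OF alt_lie[OF f]] contr_lie lie_add D_add add_ac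
          flip: lie_bracket[OF f])
  qed simp
qed

text \<open>Contraction by \<open>z\<close> yields \<open>lie z (D n f)\<close> and
  \<open>D n (lie z f)\<close>, equal by \<open>D_lie\<close>, and a square in lower degree.\<close>

lemma D_D: "alt n f \<Longrightarrow> D (Suc n) (D n f) = 0"
proof (induction n arbitrary: f)
  case 0
  then show ?case
    by - (rule contr_ext, simp_all add: contr_D[OF alt_D] contr_D D_lie)
next
  case (Suc n)
  show ?case
  proof (rule contr_ext)
    fix z
    have "D (Suc n) (D n (contr z f)) = 0"
      using Suc by simp
    then show "contr z (D (Suc (Suc n)) (D (Suc n) f)) = contr z 0"
      by (simp add: contr_D[OF alt_D[OF Suc.prems]] contr_D[OF Suc.prems] D_add D_lie[OF Suc.prems])
  qed simp
qed

section \<open>Restricted cochains\<close>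

text \<open>
  For \<open>n < 2\<close> the last two conditions on \<open>\<omega>\<close> are vacuous: \<open>\<omega>\<close> is \<open>0\<close>, and so is every double
  contraction of \<open>\<phi>\<close>.
\<close>

lemma res_cochains_iff:
  "(\<phi>, \<omega>) \<in> res_cochains scaleL scaleM n \<longleftrightarrow>
     alt n \<phi> \<and> (n < 2 \<longrightarrow> \<omega> = 0) \<and> (\<forall>x. alt (n - 2) (\<omega> x)) \<and>
     (\<forall>c x. \<omega> (scaleL c x) = sc (c ^ 2) (\<omega> x)) \<and>
     (\<forall>x y. \<omega> (x + y) = \<omega> x + \<omega> y + contr y (contr x \<phi>))"
proof (cases "n < 2")
  case True
  have zero: "(\<lambda>(x::'l) (zs::'l list). 0::'m) = 0"
    by (simp add: fun_eq_iff zero_fun_apply)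
  have "contr y (contr x \<phi>) = 0" if "alt n \<phi>" for x y
    using True that by (auto simp: less_2_cases_iff)
  then show ?thesis
    using True by (auto simp: res_cochains_def CE_cochains_iff_alt zero zero_fun_apply)
next
  case False
  have CE: "\<omega> x \<in> CE_cochains scaleL scaleM (n - 2) \<longleftrightarrow> supported_on_length (n - 2) (\<omega> x) \<and>
      multilinear scaleL scaleM (n - 2) (\<omega> x) \<and> alternating (n - 2) (\<omega> x)" for x
    by (simp add: CE_cochains_def)
  have "(\<forall>c x. \<omega> (scaleL c x) = sc (c ^ 2) (\<omega> x)) \<longleftrightarrow>
      (\<forall>c x zs. length zs = n - 2 \<longrightarrow> \<omega> (scaleL c x) zs = scaleM (c ^ 2) (\<omega> x zs))"
    if "\<And>x. alt (n - 2) (\<omega> x)"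
    using alt_length[OF that] by (fastforce simp: fun_eq_iff sc_apply)
  moreover have "(\<forall>x y. \<omega> (x + y) = \<omega> x + \<omega> y + contr y (contr x \<phi>)) \<longleftrightarrow>
      (\<forall>x y zs. length zs = n - 2 \<longrightarrow> \<omega> (x + y) zs = \<omega> x zs + \<omega> y zs + \<phi> (x # y # zs))"
    if "alt n \<phi>" and "\<And>x. alt (n - 2) (\<omega> x)"
  proof -
    have "\<phi> (x # y # zs) = 0" if "length zs \<noteq> n - 2" for x y zs
      using that False by (intro alt_length[OF \<open>alt n \<phi>\<close>]) auto
    then show ?thesis
      using alt_length[OF that(2)] unfolding fun_eq_iff pointwise
      by (metis add.right_neutral)
  qed
  ultimately show ?thesis
    using False unfolding CE_cochains_iff_alt[symmetric] res_cochains_def CE by auto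
qed

text \<open>
  This also covers \<open>n = 0\<close> and \<open>n = 1\<close>, where \<open>\<omega> = 0\<close>; for \<open>n = 0\<close> the contractions vanish as well.
\<close>

lemma res_diff_eq:
  assumes "(\<phi>, \<omega>) \<in> res_cochains scaleL scaleM n"
  shows "res_diff bracket sq act n (\<phi>, \<omega>) =
    (D n \<phi>, \<lambda>x. lie x (contr x \<phi>) + contr (sq x) \<phi> + D (n - 2) (\<omega> x))"
proof -
  have \<phi>: "alt n \<phi>" and \<omega>: "\<And>x. alt (n - 2) (\<omega> x)" and small: "n < 2 \<Longrightarrow> \<omega> = 0"
    using assms by (auto simp: res_cochains_iff)
  consider "n = 0" | "n = 1" | "2 \<le> n" by linarith
  then show ?thesis
  proof cases
    case 1
    have "lie x (contr x \<phi>) + contr (sq x) \<phi> + D (n - 2) (\<omega> x) = 0" for x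
      using \<phi> 1 small by (simp add: zero_fun_apply)
    then show ?thesis
      using 1 by (simp add: res_diff_def fun_eq_iff zero_fun_apply)
  next
    case 2
    have "(if zs = [] then \<phi> [sq x] + act x (\<phi> [x]) else 0)
        = (lie x (contr x \<phi>) + contr (sq x) \<phi> + D (n - 2) (\<omega> x)) zs" for x zs
      using 2 small alt_length[OF \<phi>]
      by (simp add: pointwise zero_fun_apply lie_def add_ac)
    then show ?thesis
      using 2 by (simp add: res_diff_def fun_eq_iff)
  next
    case 3
    have "res_delta bracket sq act n (\<phi>, \<omega>) x zs
        = (lie x (contr x \<phi>) + contr (sq x) \<phi> + D (n - 2) (\<omega> x)) zs" for x zs
    proof (cases "length zs = n - 1")
      case True
      \<comment> \<open>Entry \<open>i\<close> of \<open>zs\<close> has position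
        \<open>Suc i\<close> behind \<open>x\<close>; moving it to the front gives the bracket term
        of \<open>res_delta\<close>.\<close>
      have "\<phi> (bracket x (zs ! i) # x # omit i zs) = \<phi> (x # zs[i := bracket x (zs ! i)])"
        if "i < n - 1" for i
        using alt_move_front[OF \<phi>, of "Suc i" "x # zs" "bracket x (zs ! i)"] that True by simp
      moreover have "Suc (n - 2) = n - 1"
        using 3 by simp
      ultimately show ?thesis
        using True by (simp add: res_delta_def lie_def CE_diff_def pointwise add_ac
            del: sum.lessThan_Suc)
    next
      case False
      moreover have "Suc (length zs) \<noteq> n" "length zs \<noteq> Suc (n - 2)"
        using False 3 by auto
      ultimately show ?thesis
        using alt_length[OF \<phi>] by (simp add: res_delta_def lie_def CE_diff_def pointwise)
    qed
    then show ?thesis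
      using 3 by (simp add: res_diff_def fun_eq_iff)
  qed
qed

text \<open>The new second component is quadratic in \<open>x\<close>; its polarization must be the
  double contraction of \<open>D n \<phi>\<close>, which two uses of Cartan's formula
  compute.\<close>

lemma res_diff_closed:
  assumes "(\<phi>, \<omega>) \<in> res_cochains scaleL scaleM n"
  shows "res_diff bracket sq act n (\<phi>, \<omega>) \<in> res_cochains scaleL scaleM (Suc n)"
proof -
  have \<phi>: "alt n \<phi>" and \<omega>: "\<And>x. alt (n - 2) (\<omega> x)" and small: "n < 2 \<Longrightarrow> \<omega> = 0"
    and scale: "\<And>c x. \<omega> (scaleL c x) = sc (c ^ 2) (\<omega> x)"
    and add: "\<And>x y. \<omega> (x + y) = \<omega> x + \<omega> y + contr y (contr x \<phi>)"
    using assms by (auto simp: res_cochains_iff)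
  note c = alt_contr[OF \<phi>]
  define \<omega>' where "\<omega>' = (\<lambda>x. lie x (contr x \<phi>) + contr (sq x) \<phi> + D (n - 2) (\<omega> x))"
  have "\<omega>' x = 0" if "Suc n < 2" for x
    using that \<phi> small by (simp add: \<omega>'_def zero_fun_apply)
  then have "Suc n < 2 \<longrightarrow> \<omega>' = 0"
    by (simp add: fun_eq_iff zero_fun_apply)
  \<comment> \<open>For \<open>n < 2\<close> the truncated degrees do not fit \<open>alt_D\<close>,
    but there \<open>\<omega>\<close> is \<open>0\<close>.\<close>
  moreover have "alt (n - 1) (D (n - 2) (\<omega> x))" for x
  proof (cases "n < 2")
    case True
    then show ?thesis
      using small by (simp add: zero_fun_apply)
  next
    case False
    then have "n - 1 = Suc (n - 2)" by simp
    then show ?thesis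
      using alt_D[OF \<omega>] by simp
  qed
  then have "alt (n - 1) (\<omega>' x)" for x
    unfolding \<omega>'_def by (intro alt_add alt_lie c)
  moreover have "\<omega>' (scaleL a x) = sc (a ^ 2) (\<omega>' x)" for a x
    by (simp add: \<omega>'_def alt_contr_scale[OF \<phi>] lie_scale_left[OF c] lie_sc sc_sc scale
        sq_scale D_sc sc_add power2_eq_square)
  \<comment> \<open>The bracket term comes from \<open>sq_add\<close>, the differential of the
    double contraction from the defect of \<open>\<omega>\<close>, and the two Lie derivatives from
    polarizing \<open>lie x (contr x \<phi>)\<close>.\<close>
  moreover have "\<omega>' (x + y) = \<omega>' x + \<omega>' y + contr y (contr x (D n \<phi>))" for x y
  proof -
    have "contr y (D (n - 1) (contr x \<phi>)) = lie y (contr x \<phi>) + D (n - 2) (contr y (contr x \<phi>))"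
      using contr_D[OF c] by (simp add: numeral_2_eq_2)
    then have "contr y (contr x (D n \<phi>)) = lie x (contr y \<phi>) + contr (bracket x y) \<phi>
        + lie y (contr x \<phi>) + D (n - 2) (contr y (contr x \<phi>))"
      by (simp add: contr_D[OF \<phi>] contr_add contr_lie add_ac)
    then show ?thesis
      by (simp add: \<omega>'_def alt_contr_add[OF \<phi>] lie_add lie_add_left[OF c] sq_add add D_add add_ac)
  qed
  ultimately show ?thesis
    unfolding res_diff_eq[OF assms] \<omega>'_def[symmetric] res_cochains_iff
    using alt_D[OF \<phi>] by (simp add: numeral_2_eq_2)
qed

lemma res_diff_res_diff:
  assumes "(\<phi>, \<omega>) \<in> res_cochains scaleL scaleM n"
  shows "res_diff bracket sq act (Suc n) (res_diff bracket sq act n (\<phi>, \<omega>)) = 0"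
proof -
  have \<phi>: "alt n \<phi>" and \<omega>: "\<And>x. alt (n - 2) (\<omega> x)" and small: "n < 2 \<Longrightarrow> \<omega> = 0"
    using assms by (auto simp: res_cochains_iff)
  note c = alt_contr[OF \<phi>]
  have "D (n - 1) (D (n - 2) (\<omega> x)) = 0" for x
  proof (cases "n < 2")
    case True
    then show ?thesis
      using small by (simp add: zero_fun_apply)
  next
    case False
    then have "n - 1 = Suc (n - 2)" by simp
    then show ?thesis
      using D_D[OF \<omega>] by simp
  qed
  \<comment> \<open>Cartan's formula leaves terms cancelling in pairs: by \<open>lie_lie\<close>, by
    \<open>D_lie\<close>, and the differential of \<open>contr (sq x) \<phi>\<close> with
    itself.\<close>
  then have "lie x (contr x (D n \<phi>)) + contr (sq x) (D n \<phi>)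
      + D (n - 1) (lie x (contr x \<phi>) + contr (sq x) \<phi> + D (n - 2) (\<omega> x)) = 0" for x
    by (simp add: contr_D[OF \<phi>] lie_add D_add D_lie[OF c[simplified]] lie_lie[OF \<phi>] add_ac)
  moreover note eq = res_diff_eq[OF assms]
  moreover note res_diff_eq[OF res_diff_closed[OF assms, unfolded eq]]
  ultimately show ?thesis
    by (simp add: D_D[OF \<phi>] zero_prod_def fun_eq_iff zero_fun_apply numeral_2_eq_2)
qed

section \<open>Linear structure of the restricted complex\<close>

lemma vector_space_cochain_scale:
  "vector_space (cochain_scale scaleM :: 'k \<Rightarrow> ('l, 'm) cochain \<Rightarrow> ('l, 'm) cochain)"
  by unfold_locales
    (auto simp: cochain_scale_def fun_eq_iff plus_fun_apply M.scale_right_distrib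
      M.scale_left_distrib)

lemma cochain_scale_eq: "cochain_scale scaleM c (\<phi>, \<omega>) = (sc c \<phi>, \<lambda>x. sc c (\<omega> x))"
  by (simp add: cochain_scale_def sc_def)

text \<open>The conditions are not linear in \<open>x\<close>, but the additivity defect is linear
  in \<open>\<phi>\<close>, so they are linear in the pair.\<close>

lemma subspace_res_cochains:
  "module.subspace (cochain_scale scaleM) (res_cochains scaleL scaleM n)"
proof -
  interpret V: vector_space
    "cochain_scale scaleM :: 'k \<Rightarrow> ('l, 'm) cochain \<Rightarrow> ('l, 'm) cochain"
    by (rule vector_space_cochain_scale)
  show ?thesis
    unfolding V.subspace_def
  proof (intro conjI ballI allI)
    show "0 \<in> res_cochains scaleL scaleM n"
      by (simp add: zero_prod_def res_cochains_iff zero_fun_apply)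
  next
    fix u v :: "('l, 'm) cochain"
    assume "u \<in> res_cochains scaleL scaleM n" "v \<in> res_cochains scaleL scaleM n"
    then show "u + v \<in> res_cochains scaleL scaleM n"
      by (cases u; cases v)
        (simp add: res_cochains_iff alt_add plus_fun_apply sc_add contr_add add_ac)
  next
    fix a and u :: "('l, 'm) cochain"
    assume "u \<in> res_cochains scaleL scaleM n"
    then show "cochain_scale scaleM a u \<in> res_cochains scaleL scaleM n"
      by (cases u) (auto simp: cochain_scale_eq res_cochains_iff alt_sc zero_fun_apply sc_add sc_sc
          contr_sc mult.commute fun_eq_iff[of _ "0 :: 'l \<Rightarrow> 'l list \<Rightarrow> 'm"])
  qed
qed

lemma cochain_complex_res:
  "cochain_complex (cochain_scale scaleM) (res_cochains scaleL scaleM) (res_diff bracket sq act)"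
proof -
  interpret V: vector_space
    "cochain_scale scaleM :: 'k \<Rightarrow> ('l, 'm) cochain \<Rightarrow> ('l, 'm) cochain"
    by (rule vector_space_cochain_scale)
  show ?thesis
  proof
    fix n
    show "V.subspace (res_cochains scaleL scaleM n)"
      by (rule subspace_res_cochains)
    fix u :: "('l, 'm) cochain"
    assume u: "u \<in> res_cochains scaleL scaleM n"
    obtain \<phi> \<omega> where u_eq: "u = (\<phi>, \<omega>)" by (cases u)
    note diff_u = res_diff_eq[OF u[unfolded u_eq]]
    show "res_diff bracket sq act n u \<in> res_cochains scaleL scaleM (Suc n)"
      using u unfolding u_eq by (rule res_diff_closed)
    show "res_diff bracket sq act (Suc n) (res_diff bracket sq act n u) = 0"
      using u unfolding u_eq by (rule res_diff_res_diff)
    {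
      fix c
      \<comment> \<open>Membership is needed because \<open>res_diff_eq\<close> holds only on
        cochains.\<close>
      have "cochain_scale scaleM c u \<in> res_cochains scaleL scaleM n"
        using subspace_res_cochains u by (rule V.subspace_scale)
      then show "res_diff bracket sq act n (cochain_scale scaleM c u)
          = cochain_scale scaleM c (res_diff bracket sq act n u)"
        unfolding u_eq cochain_scale_eq diff_u
        by (simp add: res_diff_eq D_sc contr_sc lie_sc sc_add)
    next
      fix v :: "('l, 'm) cochain"
      assume v: "v \<in> res_cochains scaleL scaleM n"
      obtain \<psi> \<eta> where v_eq: "v = (\<psi>, \<eta>)" by (cases v)
      have "u + v \<in> res_cochains scaleL scaleM n"
        using subspace_res_cochains u v by (rule V.subspace_add)
      then show "res_diff bracket sq act n (u + v)
          = res_diff bracket sq act n u + res_diff bracket sq act n v"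
        unfolding u_eq v_eq add_Pair diff_u res_diff_eq[OF v[unfolded v_eq]]
        by (simp add: res_diff_eq D_add contr_add lie_add plus_fun_apply fun_eq_iff add_ac)
    }
  qed
qed

end

section \<open>Cohomology of a complex of subspaces\<close>

context cochain_complex
begin

text \<open>Since \<open>d n\<close> is linear only on \<open>C n\<close>, this rests on
  \<open>0\<close> lying in \<open>C n\<close>.\<close>

lemma d_zero: "d n 0 = 0"
  using d_scale[of 0 n 0] subspace_C[of n] by (simp add: subspace_0)

lemma subspace_cocycles: "subspace (cocycles C d n)"
  using subspace_C[of n]
  by (auto simp: subspace_def cocycles_def d_zero d_add d_scale)

lemma subspace_coboundaries: "subspace (coboundaries C d n)"
proof (cases n)
  case (Suc m)
  show ?thesis
    unfolding subspace_def Suc coboundaries.simps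
  proof (intro conjI ballI allI)
    show "0 \<in> d m ` C m"
      using subspace_0[OF subspace_C] d_zero by (metis imageI)
  next
    fix x y assume "x \<in> d m ` C m" "y \<in> d m ` C m"
    then show "x + y \<in> d m ` C m"
      using subspace_add[OF subspace_C] by (auto simp flip: d_add)
  next
    fix c x assume "x \<in> d m ` C m"
    then show "scale c x \<in> d m ` C m"
      using subspace_scale[OF subspace_C] by (auto simp flip: d_scale)
  qed
qed (simp add: subspace_def)

lemma coboundaries_subset_cocycles: "coboundaries C d n \<subseteq> cocycles C d n"
  using subspace_0[OF subspace_cocycles]
  by (cases n) (auto simp: cocycles_def d_closed d_d)

lemma comm_group_cocycle_group: "comm_group (cocycle_group C d n)"
proof (rule comm_groupI)
  fix x assume "x \<in> carrier (cocycle_group C d n)"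
  then show "\<exists>y\<in>carrier (cocycle_group C d n).
      y \<otimes>\<^bsub>cocycle_group C d n\<^esub> x = \<one>\<^bsub>cocycle_group C d n\<^esub>"
    using subspace_neg[OF subspace_cocycles]
    by (intro bexI[of _ "- x"]) (auto simp: cocycle_group_def)
qed (auto simp: cocycle_group_def add_ac subspace_add[OF subspace_cocycles]
    subspace_0[OF subspace_cocycles])

text \<open>The coboundaries form a subgroup of the abelian group of cocycles, so the quotient is an
  abelian group.\<close>

lemma comm_group_cohomology: "comm_group (cohomology C d n)"
proof -
  interpret G: comm_group "cocycle_group C d n"
    by (rule comm_group_cocycle_group)
  have "subgroup (coboundaries C d n) (cocycle_group C d n)"
  proof (rule G.subgroupI)
    show "coboundaries C d n \<noteq> {}"
      using subspace_0[OF subspace_coboundaries] by blast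
  next
    fix x assume x: "x \<in> coboundaries C d n"
    then have "- x \<in> coboundaries C d n"
      by (rule subspace_neg[OF subspace_coboundaries])
    \<comment> \<open>Uniqueness of inverses identifies the inverse of the group record with
      additive negation.\<close>
    moreover from this x have "inv\<^bsub>cocycle_group C d n\<^esub> x = - x"
      using coboundaries_subset_cocycles
      by (intro G.inv_equality) (auto simp: cocycle_group_def)
    ultimately show "inv\<^bsub>cocycle_group C d n\<^esub> x \<in> coboundaries C d n"
      by simp
  qed (use coboundaries_subset_cocycles
      subspace_add[OF subspace_coboundaries] in \<open>auto simp: cocycle_group_def\<close>)
  then show ?thesis
    unfolding cohomology_def by (rule G.abelian_FactGroup)
qed

end

theorem theorem5p8:
  fixes scaleL :: "'k::field \<Rightarrow> 'l::ab_group_add \<Rightarrow> 'l"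
    and scaleM :: "'k \<Rightarrow> 'm::ab_group_add \<Rightarrow> 'm"
    and bracket :: "'l \<Rightarrow> 'l \<Rightarrow> 'l" and sq :: "'l \<Rightarrow> 'l" and act :: "'l \<Rightarrow> 'm \<Rightarrow> 'm"
  assumes "restricted_lie_module_char2 scaleL bracket sq scaleM act"
  shows "cochain_complex (cochain_scale scaleM)
           (res_cochains scaleL scaleM) (res_diff bracket sq act) \<and>
    (\<forall>n. module.subspace (cochain_scale scaleM)
           (cocycles (res_cochains scaleL scaleM) (res_diff bracket sq act) n) \<and>
         module.subspace (cochain_scale scaleM)
           (coboundaries (res_cochains scaleL scaleM) (res_diff bracket sq act) n) \<and>
         coboundaries (res_cochains scaleL scaleM) (res_diff bracket sq act) n
           \<subseteq> cocycles (res_cochains scaleL scaleM) (res_diff bracket sq act) n \<and>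
         comm_group (cohomology (res_cochains scaleL scaleM) (res_diff bracket sq act) n))"
proof -
  interpret restricted_lie_module_char2 scaleL bracket sq scaleM act
    by (rule assms)
  interpret C: cochain_complex "cochain_scale scaleM" "res_cochains scaleL scaleM"
    "res_diff bracket sq act"
    by (rule cochain_complex_res)
  show ?thesis
    by (intro conjI allI C.cochain_complex_axioms C.subspace_cocycles C.subspace_coboundaries
        C.coboundaries_subset_cocycles C.comm_group_cohomology)
qed

end
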